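(* Let $S\subseteq\mathbb N$ be a numerical semigroup with multiplicity $m$, embedding dimension $\nu$ and conductor $f+1=qm-\rho$ for some $q\in\mathbb N$ and $0\le\rho\le m-1$. Let $\mathrm{Ap}(S,m)=\{w_0=0<w_1<\dots<w_{m-1}\}$. Suppose that $w_{m-1}\ge w_1+w_\alpha$ for some integer $\alpha$ with $1<\alpha<m-1$. If $\left(2+\frac{\alpha-3}{q}\right)\nu\ge m$, then $S$ satisfies Wilf's Conjecture, i.e. $f+1\le \nu\, n$.
   Context: A numerical semigroup is a submonoid of $(\mathbb N,+)$ with finite complement. $f$ is the Frobenius number (largest integer not in $S$), $m$ the smallest nonzero element of $S$, $\nu$ the minimal number of generators, and $n=|\{s\in S: s<f\}|$. The Apéry set is $\mathrm{Ap}(S,m)=\{s\in S: s-m\notin S\}$, which has exactly $m$ elements, listed increasingly as $w_0<\dots<w_{m-1}$. $S$ satisfies Wilf's Conjecture if $f+1\le \nu n$. *)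

theory Defs
  imports Complex_Main "HOL.Hull"
begin

definition add_submonoid :: "nat set \<Rightarrow> bool" where
  "add_submonoid M \<longleftrightarrow> 0 \<in> M \<and> (\<forall>x\<in>M. \<forall>y\<in>M. x + y \<in> M)"

definition numerical_semigroup :: "nat set \<Rightarrow> bool" where
  "numerical_semigroup S \<longleftrightarrow> add_submonoid S \<and> finite (- S)"

definition multiplicity :: "nat set \<Rightarrow> nat" where
  "multiplicity S = (LEAST s. s \<in> S \<and> s \<noteq> 0)"

(* The maximum is taken over the integers, so the Frobenius number of the full
   set of naturals is -1 and its conductor is 0. *)
definition frobenius :: "nat set \<Rightarrow> int" where
  "frobenius S = (GREATEST x. x \<notin> int ` S)"

(* add_submonoid hull A is the submonoid generated by A. Finiteness of A is
   required because card is 0 on infinite sets. *)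
definition embedding_dim :: "nat set \<Rightarrow> nat" where
  "embedding_dim S = (LEAST k. \<exists>A. finite A \<and> card A = k \<and> add_submonoid hull A = S)"

definition num_left :: "nat set \<Rightarrow> nat" where
  "num_left S = card {s \<in> S. int s < frobenius S}"

(* The difference s - m is an integer and may be negative. *)
definition Apery :: "nat set \<Rightarrow> nat \<Rightarrow> nat set" where
  "Apery S m = {s \<in> S. int s - int m \<notin> int ` S}"

definition satisfies_wilf :: "nat set \<Rightarrow> bool" where
  "satisfies_wilf S \<longleftrightarrow> frobenius S + 1 \<le> int (embedding_dim S * num_left S)"

end

theory Submission
  imports Defs
begin

text \<open>
  Put \<open>c j = (w j + \<rho>) div m\<close>. For each \<open>j\<close> exactly \<open>q - c j\<close> elements of the form
  \<open>w j + t * m\<close> lie below the conductor \<open>q * m - \<rho>\<close>, and different pairs \<open>(j, t)\<close> give different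
  elements, so \<open>n\<close> is at least the sum of \<open>q - c j\<close> over \<open>j \<le> \<alpha>\<close>. Apery elements are at most
  \<open>f + m\<close>; hence \<open>w 1 + w \<alpha> \<le> w (m - 1)\<close> yields \<open>c 1 + c \<alpha> \<le> q + 1\<close> and, as \<open>w 1 \<ge> m\<close>,
  also \<open>c j < q\<close> for \<open>j \<le> \<alpha>\<close>. The indices \<open>0\<close>, \<open>1\<close>, \<open>\<alpha>\<close> therefore contribute at least
  \<open>q + (q - 1)\<close> and the \<open>\<alpha> - 2\<close> others at least \<open>1\<close> each, so that \<open>n \<ge> 2 * q + \<alpha> - 3\<close>.
\<close>

text \<open>\<open>GREATEST\<close> is meaningful because the maximum is attained in a finite set:
  the gaps in the naturals, together with \<open>-1\<close>, which dominates all negative integers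
  and keeps the set nonempty when there are no gaps.\<close>

lemma frobenius_notin_and_greatest:
  assumes "numerical_semigroup S"
  shows "frobenius S \<notin> int ` S" and "x \<notin> int ` S \<Longrightarrow> x \<le> frobenius S"
proof -
  define A where "A = insert (-1) (int ` (- S))"
  have fin: "finite A" and ne: "A \<noteq> {}"
    using assms by (auto simp: A_def numerical_semigroup_def)
  have Max_notin: "Max A \<notin> int ` S"
    using Max_in[OF fin ne] by (auto simp: A_def simp del: Max_in)
  have le_Max: "y \<le> Max A" if "y \<notin> int ` S" for y
  proof (cases "y < 0")
    case True
    then have "y \<le> -1" by simp
    also have "-1 \<le> Max A" using fin by (intro Max_ge) (auto simp: A_def)
    finally show ?thesis .
  next
    case False
    then have "y = int (nat y)" by simp
    with that have "y \<in> A" unfolding A_def by blast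
    with fin show ?thesis by (rule Max_ge)
  qed
  have "frobenius S = Max A"
    unfolding frobenius_def by (rule Greatest_equality) (use Max_notin le_Max in auto)
  then show "frobenius S \<notin> int ` S" and "x \<notin> int ` S \<Longrightarrow> x \<le> frobenius S"
    using Max_notin le_Max by simp_all
qed

lemma multiplicity_in:
  assumes "numerical_semigroup S"
  shows "multiplicity S \<in> S" and "multiplicity S > 0"
proof -
  have "\<exists>s. s \<in> S \<and> s \<noteq> 0"
  proof (rule ccontr)
    assume "\<not> ?thesis"
    then have "{1..} \<subseteq> - S" by auto
    with assms have "finite {1::nat..}"
      unfolding numerical_semigroup_def using finite_subset by blast
    then show False by (simp add: infinite_Ici)
  qed
  then have "multiplicity S \<in> S \<and> multiplicity S \<noteq> 0"
    unfolding multiplicity_def by (rule LeastI_ex)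
  then show "multiplicity S \<in> S" and "multiplicity S > 0" by auto
qed

lemma multiplicity_le: "s \<in> S \<Longrightarrow> s \<noteq> 0 \<Longrightarrow> multiplicity S \<le> s"
  unfolding multiplicity_def by (rule Least_le) simp

lemma add_mult_in:
  assumes "add_submonoid M" "x \<in> M" "y \<in> M"
  shows "x + t * y \<in> M"
proof (induction t)
  case (Suc t)
  then have "(x + t * y) + y \<in> M" using assms by (simp add: add_submonoid_def)
  then show ?case by (simp add: algebra_simps)
qed (use assms in simp)

lemma Apery_le_frobenius:
  assumes "numerical_semigroup S" "s \<in> Apery S k"
  shows "int s \<le> frobenius S + int k"
  using frobenius_notin_and_greatest(2)[OF assms(1), of "int s - int k"] assms(2)
  by (simp add: Apery_def)

lemma zero_in_Apery:
  assumes "add_submonoid S" "k > 0"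
  shows "0 \<in> Apery S k"
  using assms by (auto simp: Apery_def add_submonoid_def)

text \<open>Removing a single copy of \<open>m\<close> from \<open>b + t * m\<close> leaves an
  element of \<open>S\<close>, which membership of \<open>a\<close> in the Apery set
  forbids.\<close>

lemma Apery_not_add_mult:
  assumes "add_submonoid S" "m \<in> S" "a \<in> Apery S m" "b \<in> S" "t > 0"
  shows "a \<noteq> b + t * m"
proof
  assume eq: "a = b + t * m"
  from \<open>t > 0\<close> obtain t' where "t = Suc t'" by (cases t) auto
  with eq have "int a - int m = int (b + t' * m)" by (simp add: algebra_simps)
  moreover have "b + t' * m \<in> S" using assms by (intro add_mult_in)
  ultimately show False using assms(3) unfolding Apery_def by (metis (lifting) image_eqI mem_Collect_eq)
qed

text \<open>Cancelling the smaller multiple of \<open>m\<close> would otherwise exhibit one Apery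
  element as the other plus a positive multiple of \<open>m\<close>.\<close>

lemma Apery_add_mult_inj:
  assumes "add_submonoid S" "m \<in> S" "a \<in> Apery S m" "b \<in> Apery S m"
    and eq: "a + t * m = b + u * m"
  shows "a = b \<and> t = u"
proof -
  have "a \<in> S" "b \<in> S" using assms by (auto simp: Apery_def)
  consider "t = u" | "t < u" | "u < t" by linarith
  then show ?thesis
  proof cases
    case 1
    with eq show ?thesis by simp
  next
    case 2
    then have "u * m = t * m + (u - t) * m"
      by (metis add_mult_distrib le_add_diff_inverse less_imp_le)
    with eq have "a = b + (u - t) * m" by simp
    with Apery_not_add_mult[OF assms(1-3) \<open>b \<in> S\<close>, of "u - t"] 2 show ?thesis by simp
  next
    case 3
    then have "t * m = u * m + (t - u) * m"
      by (metis add_mult_distrib le_add_diff_inverse less_imp_le)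
    with eq have "b = a + (t - u) * m" by simp
    with Apery_not_add_mult[OF assms(1,2,4) \<open>a \<in> S\<close>, of "t - u"] 3 show ?thesis by simp
  qed
qed

text \<open>Truncated subtraction makes a summand \<open>0\<close> as soon as
  \<open>w j + \<rho> \<ge> q * m\<close>, so any finite family of distinct Apery elements may be
  counted.\<close>

lemma sum_le_num_left:
  fixes w :: "nat \<Rightarrow> nat"
  assumes S: "numerical_semigroup S" and m: "m \<in> S" "m > 0"
    and cond: "frobenius S + 1 = int q * int m - int \<rho>"
    and "finite J" and inj: "inj_on w J" and w: "w ` J \<subseteq> Apery S m"
  shows "(\<Sum>j\<in>J. q - (w j + \<rho>) div m) \<le> num_left S"
proof -
  have sub: "add_submonoid S" using S by (simp add: numerical_semigroup_def)
  define T where "T = (SIGMA j:J. {..<q - (w j + \<rho>) div m})"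
  define g where "g = (\<lambda>(j, t). w j + t * m)"
  have "inj_on g T"
  proof (rule inj_onI)
    fix x y assume xy: "x \<in> T" "y \<in> T" "g x = g y"
    obtain j t k u where jk: "x = (j, t)" "y = (k, u)" by (cases x, cases y) auto
    with xy have J: "j \<in> J" "k \<in> J" and eq: "w j + t * m = w k + u * m"
      by (auto simp: T_def g_def)
    then have "w j = w k \<and> t = u"
      using Apery_add_mult_inj[OF sub m(1) _ _ eq] w by blast
    with inj J jk show "x = y" by (simp add: inj_on_eq_iff)
  qed
  moreover have "g ` T \<subseteq> {s \<in> S. int s < frobenius S}"
  proof
    fix s assume "s \<in> g ` T"
    then obtain j t where jt: "j \<in> J" "t < q - (w j + \<rho>) div m" and s: "s = w j + t * m"
      by (auto simp: T_def g_def)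
    have "w j \<in> S" using jt(1) w by (auto simp: Apery_def)
    then have "s \<in> S" using s sub m(1) by (simp add: add_mult_in)
    have "(s + \<rho>) div m = (w j + \<rho>) div m + t"
    proof -
      have "s + \<rho> = (w j + \<rho>) + t * m" using s by simp
      then show ?thesis using m(2) by (simp only: div_mult_self1)
    qed
    with jt(2) have "(s + \<rho>) div m < q" by linarith
    then have "s + \<rho> < q * m" using m(2) by (simp add: div_less_iff_less_mult)
    then have "int s + int \<rho> < int q * int m" by (metis of_nat_add of_nat_less_iff of_nat_mult)
    with cond have "int s \<le> frobenius S" by linarith
    \<comment> \<open>\<open>num_left\<close> counts strictly below the Frobenius number; the value
      itself is excluded because it is a gap.\<close>
    moreover have "int s \<noteq> frobenius S"
      using frobenius_notin_and_greatest(1)[OF S] \<open>s \<in> S\<close> by (metis image_eqI)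
    ultimately show "s \<in> {s \<in> S. int s < frobenius S}" using \<open>s \<in> S\<close> by simp
  qed
  moreover have "finite {s \<in> S. int s < frobenius S}"
    by (rule finite_subset[of _ "{..<nat (frobenius S)}"]) auto
  ultimately have "card T \<le> num_left S"
    unfolding num_left_def by (meson card_inj_on_le)
  then show ?thesis using \<open>finite J\<close> by (simp add: T_def)
qed

theorem theorem1:
  fixes S :: "nat set" and m \<nu> q \<rho> \<alpha> :: nat and w :: "nat \<Rightarrow> nat"
  assumes "numerical_semigroup S"
    and "m = multiplicity S"
    and "\<nu> = embedding_dim S"
    and "frobenius S + 1 = int q * int m - int \<rho>"
    and "0 \<le> \<rho>" and "\<rho> \<le> m - 1"
    and "strict_mono_on {..<m} w" and "w ` {..<m} = Apery S m"
    and "1 < \<alpha>" and "\<alpha> < m - 1"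
    and "w (m - 1) \<ge> w 1 + w \<alpha>"
    and "(2 + (real \<alpha> - 3) / real q) * real \<nu> \<ge> real m"
  shows "satisfies_wilf S"
proof (cases "q = 0")
  \<comment> \<open>The numerical hypothesis divides by \<open>q\<close>, so \<open>q = 0\<close> is
    split off: there the conductor is at most \<open>0\<close>.\<close>
  case True
  with assms(4) have "frobenius S + 1 \<le> 0" by simp
  then show ?thesis unfolding satisfies_wilf_def by (smt (verit) of_nat_0_le_iff)
next
  case False
  have S: "add_submonoid S" using assms(1) by (simp add: numerical_semigroup_def)
  have m: "m \<in> S" "m > 0" using multiplicity_in[OF assms(1)] assms(2) by simp_all
  have wA: "w j \<in> Apery S m" if "j < m" for j using assms(8) that by blast
  have mono: "w i < w j" if "i < j" "j < m" for i j
    using assms(7) that by (simp add: strict_mono_onD)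
  have "0 \<in> w ` {..<m}" using zero_in_Apery[OF S m(2)] assms(8) by simp
  then obtain i where i: "i < m" "w i = 0" by auto
  then have w0: "w 0 = 0" using mono[of 0 i] by (cases "i = 0") auto
  have "w 1 \<noteq> 0" using mono[of 0 1] assms(9,10) by linarith
  then have w1: "w 1 \<ge> m"
    using multiplicity_le[of "w 1" S] wA[of 1] assms(2,9,10) by (auto simp: Apery_def)

  define c where "c j = (w j + \<rho>) div m" for j
  have c0: "c 0 = 0" using w0 assms(6) m(2) by (simp add: c_def)
  have "int (w (m - 1)) \<le> frobenius S + int m"
    by (rule Apery_le_frobenius[OF assms(1) wA]) (use m(2) in simp)
  with assms(4) have "int (w (m - 1) + \<rho>) < int (q * m + m)" by simp
  then have top: "w 1 + w \<alpha> + \<rho> < q * m + m" using assms(11) by linarith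
  have c_less: "c j < q" if "j \<le> \<alpha>" for j
  proof -
    have "\<alpha> < m" using assms(10) by simp
    then have "w j \<le> w \<alpha>" using mono[of j \<alpha>] that by (cases "j = \<alpha>") auto
    with top w1 have "w j + \<rho> < q * m" by linarith
    then show ?thesis unfolding c_def using m(2) by (simp add: div_less_iff_less_mult)
  qed
  have c_sum: "c 1 + c \<alpha> \<le> q + 1"
  proof -
    have "c 1 * m \<le> w 1 + \<rho>" "c \<alpha> * m \<le> w \<alpha> + \<rho>" by (simp_all add: c_def)
    \<comment> \<open>Adding the two bounds counts \<open>\<rho>\<close> twice, while
      \<open>top\<close> absorbs it once; the second copy costs less than one further
      \<open>m\<close>.\<close>
    then have "(c 1 + c \<alpha>) * m < (q + 2) * m"
      using top assms(6) m(2) by (simp add: algebra_simps)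
    then have "c 1 + c \<alpha> < q + 2" by (simp only: mult_less_cancel2)
    then show ?thesis by simp
  qed

  have "inj_on w {..\<alpha>}"
    using strict_mono_on_imp_inj_on[OF assms(7)] by (rule inj_on_subset) (use assms(10) in auto)
  then have n: "(\<Sum>j\<le>\<alpha>. q - c j) \<le> num_left S"
    unfolding c_def using assms(8,10)
    by (intro sum_le_num_left[OF assms(1) m assms(4)]) auto
  have "{..\<alpha>} = {0, 1, \<alpha>} \<union> {2..<\<alpha>}" using assms(9) by auto
  then have "(\<Sum>j\<le>\<alpha>. q - c j) = (\<Sum>j\<in>{0, 1, \<alpha>}. q - c j) + (\<Sum>j=2..<\<alpha>. q - c j)"
    by (simp only:) (rule sum.union_disjoint, auto)
  moreover have "(\<Sum>j\<in>{0, 1, \<alpha>}. q - c j) = q + ((q - c 1) + (q - c \<alpha>))"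
    using assms(9) c0 by simp
  moreover have "(\<Sum>j=2..<\<alpha>. q - c j) \<ge> (\<Sum>j=2..<\<alpha>. 1)"
    by (rule sum_mono) (use c_less in \<open>auto simp: Suc_le_eq\<close>)
  \<comment> \<open>By \<open>c_less\<close> the differences \<open>q - c 1\<close> and
    \<open>q - c \<alpha>\<close> are not truncated. The \<open>3\<close> stays on the right to
    avoid subtraction in \<open>nat\<close>.\<close>
  ultimately have "2 * q + \<alpha> \<le> num_left S + 3"
    using n c_sum c_less[of 1] c_less[of \<alpha>] assms(9) by simp
  then have num: "2 * real q + (real \<alpha> - 3) \<le> real (num_left S)" by linarith

  \<comment> \<open>Multiplying by \<open>q\<close> clears the denominator and bounds
    \<open>q * m\<close>, which is at least the conductor.\<close>
  have "real q * real m \<le> real q * ((2 + (real \<alpha> - 3) / real q) * real \<nu>)"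
    using assms(12) by (intro mult_left_mono) auto
  also have "\<dots> = (2 * real q + (real \<alpha> - 3)) * real \<nu>"
    using False by (simp add: field_simps)
  also have "\<dots> \<le> real (num_left S) * real \<nu>"
    using num by (intro mult_right_mono) auto
  finally have "real (q * m) \<le> real (\<nu> * num_left S)" by (simp add: mult.commute)
  then have "int q * int m \<le> int (\<nu> * num_left S)"
    by (metis of_nat_le_iff of_nat_mult)
  with assms(3,4) show ?thesis by (simp add: satisfies_wilf_def)
qed

end
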